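(* Let $G$ be a graph. The following are equivalent: (1) $G$ has an Eulerian cut; (2) there is a non-constant harmonic morphism from $G$ to $B_2$; (3) $\kappa_G$ is even.
   Context: A graph is a finite, connected multigraph without loop edges. $\kappa_G$ denotes the number of spanning trees of $G$, and $B_2$ is the graph with two vertices joined by two parallel edges. An Eulerian cut is a partition of $V(G)$ into non-empty disjoint sets $X,X'$ such that every vertex of $X$ is joined by an even number of edges to vertices in $X'$, and every vertex of $X'$ is joined by an even number of edges to vertices in $X$. A morphism $\phi:G\to G'$ is a map $V(G)\cup E(G)\to V(G')\cup E(G')$ sending vertices to vertices such that, for each edge $e$ incident to $x$, either $\phi(e)\in E(G')$ has $\phi(x)$ as an endpoint, or $\phi(e)=\phi(x)$. It is harmonic if, for each $x\in V(G)$, the number $|\{e: x\in e,\ \phi(e)=e'\}|$ is the same for all edges $e'\in E(G')$ incident to $\phi(x)$. It is non-constant if it does not map $V(G)$ to a single vertex.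
   Formalization: A morphism is also required to send an edge xy mapped to an edge e' so that φ(x), φ(y) are exactly the two ends of e'; without this, two triangles sharing a vertex (9 spanning trees) would have a non-constant harmonic morphism to B_2. *)

theory Defs
  imports Main
begin

record ('v, 'e) mgraph =
  mverts :: "'v set"
  medges :: "'e set"
  mends :: "'e \<Rightarrow> 'v set"

definition mg_adj :: "('v, 'e) mgraph \<Rightarrow> ('v \<times> 'v) set" where
  "mg_adj G = {(u, v). \<exists>e \<in> medges G. mends G e = {u, v}}"

definition mg_connected :: "('v, 'e) mgraph \<Rightarrow> bool" where
  "mg_connected G \<longleftrightarrow> mverts G \<noteq> {} \<and> (\<forall>u \<in> mverts G. \<forall>v \<in> mverts G. (u, v) \<in> (mg_adj G)\<^sup>*)"

text \<open>Finite connected multigraphs. Loop edges are excluded because every edge has exactly two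
  distinct ends; parallel edges are allowed because \<^const>\<open>mends\<close> need not be injective.\<close>

locale multigraph =
  fixes G :: "('v, 'e) mgraph"
  assumes finite_mverts: "finite (mverts G)"
    and finite_medges: "finite (medges G)"
    and mends_subset: "e \<in> medges G \<Longrightarrow> mends G e \<subseteq> mverts G"
    and card_mends: "e \<in> medges G \<Longrightarrow> card (mends G e) = 2"
    and connected: "mg_connected G"

text \<open>A cycle visits the distinct vertices \<open>vs\<close> in cyclic order along the distinct edges \<open>es\<close>.
  Two parallel edges form a cycle of length 2; length 1 would be a loop edge.\<close>

definition mg_cycle :: "('v, 'e) mgraph \<Rightarrow> 'v list \<Rightarrow> 'e list \<Rightarrow> bool" where
  "mg_cycle G vs es \<longleftrightarrow>
     vs \<noteq> [] \<and> length es = length vs \<and> distinct vs \<and> distinct es \<and>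
     set vs \<subseteq> mverts G \<and> set es \<subseteq> medges G \<and>
     (\<forall>i < length vs. mends G (es ! i) = {vs ! i, vs ! (Suc i mod length vs)})"

definition mg_tree :: "('v, 'e) mgraph \<Rightarrow> bool" where
  "mg_tree G \<longleftrightarrow> mg_connected G \<and> (\<nexists>vs es. mg_cycle G vs es)"

text \<open>A spanning tree is identified with its edge set, so that trees using different parallel edges
  are counted separately.\<close>

definition spanning_trees :: "('v, 'e) mgraph \<Rightarrow> 'e set set" where
  "spanning_trees G = {T. T \<subseteq> medges G \<and> mg_tree (G\<lparr>medges := T\<rparr>)}"

definition num_spanning_trees :: "('v, 'e) mgraph \<Rightarrow> nat" where
  "num_spanning_trees G = card (spanning_trees G)"

definition mg_B2 :: "(bool, bool) mgraph" where
  "mg_B2 = \<lparr>mverts = UNIV, medges = UNIV, mends = (\<lambda>_. UNIV)\<rparr>"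

lemma multigraph_B2: "multigraph mg_B2"
proof
  show "mg_connected mg_B2"
    by (auto simp: mg_connected_def mg_adj_def mg_B2_def UNIV_bool intro: r_into_rtrancl)
qed (simp_all add: mg_B2_def card_UNIV_bool)

definition eulerian_cut :: "('v, 'e) mgraph \<Rightarrow> 'v set \<Rightarrow> 'v set \<Rightarrow> bool" where
  "eulerian_cut G X X' \<longleftrightarrow>
     X \<noteq> {} \<and> X' \<noteq> {} \<and> X \<inter> X' = {} \<and> X \<union> X' = mverts G \<and>
     (\<forall>x \<in> X. even (card {e \<in> medges G. \<exists>y \<in> X'. mends G e = {x, y}})) \<and>
     (\<forall>x \<in> X'. even (card {e \<in> medges G. \<exists>y \<in> X. mends G e = {x, y}}))"

text \<open>A morphism is a map on the disjoint union of vertices (\<^const>\<open>Inl\<close>) and edges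
  (\<^const>\<open>Inr\<close>); its values outside \<open>mverts G <+> medges G\<close> are irrelevant.

  The last conjunct is the usual requirement (Baker and Norine) that an edge with ends \<open>x\<close>, \<open>y\<close>
  that is sent to an edge \<open>e'\<close> is sent to one with ends \<open>\<phi> x\<close>, \<open>\<phi> y\<close>. Since \<open>e'\<close> is not a
  loop, this means that an edge whose ends have the same image must be contracted to that image.
  Applying the preceding incidence condition to each end separately does not imply this: it
  would allow an edge with \<open>\<phi> x = \<phi> y\<close> to be mapped onto an edge at \<open>\<phi> x\<close>. With that reading, the
  graph formed by two triangles sharing a vertex (9 spanning trees, no Eulerian cut) would have
  a non-constant harmonic morphism to \<^term>\<open>mg_B2\<close>: map its 6 edges alternately to the two edges
  along an Euler tour, and the vertices in any non-constant way.\<close>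

definition mg_morphism ::
  "('v, 'e) mgraph \<Rightarrow> ('w, 'f) mgraph \<Rightarrow> ('v + 'e \<Rightarrow> 'w + 'f) \<Rightarrow> bool" where
  "mg_morphism G G' \<phi> \<longleftrightarrow>
     \<phi> ` (mverts G <+> medges G) \<subseteq> mverts G' <+> medges G' \<and>
     \<phi> ` Inl ` mverts G \<subseteq> Inl ` mverts G' \<and>
     (\<forall>x \<in> mverts G. \<forall>e \<in> medges G. x \<in> mends G e \<longrightarrow>
        (\<exists>e' \<in> medges G'. \<phi> (Inr e) = Inr e' \<and> \<phi> (Inl x) \<in> Inl ` mends G' e') \<or>
        \<phi> (Inr e) = \<phi> (Inl x)) \<and>
     (\<forall>e \<in> medges G. \<forall>e' \<in> medges G'. \<phi> (Inr e) = Inr e' \<longrightarrow>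
        \<phi> ` Inl ` mends G e = Inl ` mends G' e')"

definition harmonic_morphism ::
  "('v, 'e) mgraph \<Rightarrow> ('w, 'f) mgraph \<Rightarrow> ('v + 'e \<Rightarrow> 'w + 'f) \<Rightarrow> bool" where
  "harmonic_morphism G G' \<phi> \<longleftrightarrow>
     mg_morphism G G' \<phi> \<and>
     (\<forall>x \<in> mverts G. \<forall>e' \<in> medges G'. \<forall>e'' \<in> medges G'.
        \<phi> (Inl x) \<in> Inl ` mends G' e' \<longrightarrow> \<phi> (Inl x) \<in> Inl ` mends G' e'' \<longrightarrow>
        card {e \<in> medges G. x \<in> mends G e \<and> \<phi> (Inr e) = Inr e'} =
        card {e \<in> medges G. x \<in> mends G e \<and> \<phi> (Inr e) = Inr e''})"

definition nonconstant ::
  "('v, 'e) mgraph \<Rightarrow> ('w, 'f) mgraph \<Rightarrow> ('v + 'e \<Rightarrow> 'w + 'f) \<Rightarrow> bool" where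
  "nonconstant G G' \<phi> \<longleftrightarrow> \<not> (\<exists>y \<in> mverts G'. \<forall>x \<in> mverts G. \<phi> (Inl x) = Inl y)"

end

theory Submission
  imports Defs
begin

text \<open>Given an Eulerian cut, pair up the cut edges at each vertex. The two pairings, one for each side
  of the cut, are fixed-point-free involutions of the set of cut edges, so their union consists of
  even cycles and can be 2-coloured; the colour is the image in \<^const>\<open>mg_B2\<close>. Conversely a
  harmonic morphism sends equally many edges at each vertex to either edge of \<^const>\<open>mg_B2\<close>.

  Eulerian cuts are the nonzero kernel vectors of the Laplacian modulo 2 with one vertex \<open>r\<close>
  deleted. The matrix-tree theorem modulo 2 follows without determinants: contract a growing set
  \<open>R\<close> of vertices and take an edge \<open>e\<close> from \<open>R\<close> to \<open>a \<notin> R\<close>. The number of spanning trees satisfies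
  \<open>\<kappa>(E, R) = \<kappa>(E - e, R) + \<kappa>(E - e, R \<union> {a})\<close>, and so does, modulo 2, the indicator of
  nonsingularity of the Laplacian restricted to the complement of \<open>R\<close>.\<close>

section \<open>Parity and balanced two-colourings\<close>

text \<open>Sets serve throughout as vectors over the field with two elements, with
  \<open>sym_diff\<close> as addition; this is the additivity of parity.\<close>

lemma odd_card_sym_diff:
  assumes "finite A" "finite B"
  shows "odd (card (sym_diff A B)) \<longleftrightarrow> odd (card A) \<noteq> odd (card B)"
proof -
  have "card (sym_diff A B) = card (A - B) + card (B - A)"
    using assms by (intro card_Un_disjoint) auto
  moreover have "card A = card (A - B) + card (A \<inter> B)"
    using assms by (subst card_Un_disjoint[symmetric]) (auto intro: arg_cong[where f = card])
  moreover have "card B = card (B - A) + card (A \<inter> B)"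
    using assms by (subst card_Un_disjoint[symmetric]) (auto intro: arg_cong[where f = card])
  ultimately show ?thesis by presburger
qed

text \<open>A fibre of even size that contains \<open>e\<close> contains a partner \<open>f\<close>;
  pairing these two and removing them leaves all fibres even, so induction applies.\<close>

lemma fibre_pairing:
  assumes "finite E" and "\<And>x. even (card {e \<in> E. s e = x})"
  obtains a where "\<And>e. e \<in> E \<Longrightarrow> a e \<in> E \<and> a e \<noteq> e \<and> a (a e) = e \<and> s (a e) = s e"
proof -
  have "\<exists>a. \<forall>e\<in>E. a e \<in> E \<and> a e \<noteq> e \<and> a (a e) = e \<and> s (a e) = s e"
    using assms
  proof (induction E rule: finite_psubset_induct)
    case (psubset E)
    show ?case
    proof (cases "E = {}")
      case False
      then obtain e where e: "e \<in> E" by auto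
      let ?F = "{g \<in> E. s g = s e}"
      have "?F \<noteq> {e}"
        using psubset.prems[of "s e"] by (metis card.empty card_insert_disjoint empty_iff finite.emptyI odd_one One_nat_def)
      then obtain f where f: "f \<in> E" "s f = s e" "f \<noteq> e" using e by blast
      have "even (card {g \<in> E - {e, f}. s g = x})" for x
      proof (cases "x = s e")
        case True
        have "{g \<in> E - {e, f}. s g = x} = ?F - {e, f}" using True by auto
        moreover have "card (?F - {e, f}) = card ?F - 2"
          using e f psubset.hyps by (subst card_Diff_subset) auto
        ultimately show ?thesis using psubset.prems[of "s e"] by simp
      next
        case False
        then have "{g \<in> E - {e, f}. s g = x} = {g \<in> E. s g = x}" using f by auto
        then show ?thesis using psubset.prems[of x] by simp
      qed
      then obtain a where a: "\<forall>g\<in>E - {e, f}. a g \<in> E - {e, f} \<and> a g \<noteq> g \<and> a (a g) = g \<and> s (a g) = s g"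
        using psubset.IH[of "E - {e, f}"] e by blast
      have "\<forall>g\<in>E. (a(e := f, f := e)) g \<in> E \<and> (a(e := f, f := e)) g \<noteq> g \<and>
          (a(e := f, f := e)) ((a(e := f, f := e)) g) = g \<and> s ((a(e := f, f := e)) g) = s g"
        using a e f by auto
      then show ?thesis by blast
    qed auto
  qed
  then show ?thesis using that by blast
qed

text \<open>Applying \<open>a\<close> and \<open>b\<close> in turn runs through even cycles. The
  induction removes an \<open>a\<close>-pair \<open>{e, f}\<close>: \<open>a\<close> restricts to
  the rest, while \<open>b\<close> may have to be rewired, hence the generalisation over
  \<open>b\<close>.\<close>

lemma two_pairings_alternating:
  assumes "finite E"
    and "\<And>e. e \<in> E \<Longrightarrow> a e \<in> E \<and> a e \<noteq> e \<and> a (a e) = e"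
    and "\<And>e. e \<in> E \<Longrightarrow> b e \<in> E \<and> b e \<noteq> e \<and> b (b e) = e"
  shows "\<exists>A. \<forall>e\<in>E. (a e \<in> A \<longleftrightarrow> e \<notin> A) \<and> (b e \<in> A \<longleftrightarrow> e \<notin> A)"
  using assms
proof (induction E arbitrary: b rule: finite_psubset_induct)
  case (psubset E)
  note a = psubset.prems(1) and b = psubset.prems(2)
  show ?case
  proof (cases "E = {}")
    case False
    then obtain e where e: "e \<in> E" by auto
    define f where "f = a e"
    have f: "f \<in> E" "f \<noteq> e" "a f = e" using a[OF e] by (auto simp: f_def)
    have a': "a g \<in> E - {e, f} \<and> a g \<noteq> g \<and> a (a g) = g" if "g \<in> E - {e, f}" for g
      using a[of g] that f f_def by auto
    have sub: "E - {e, f} \<subset> E" using e by auto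
    show ?thesis
    proof (cases "b e = f")
      case True
      have bf: "b f = e" using b[OF e] True by auto
      have b': "b g \<in> E - {e, f} \<and> b g \<noteq> g \<and> b (b g) = g" if "g \<in> E - {e, f}" for g
        using b[of g] that True bf by auto
      from psubset.IH[OF sub a' b'] obtain A where
        A: "\<forall>g\<in>E - {e, f}. (a g \<in> A \<longleftrightarrow> g \<notin> A) \<and> (b g \<in> A \<longleftrightarrow> g \<notin> A)" by blast
      \<comment> \<open>Here \<open>{e, f}\<close> is a cycle of its own, so its colouring is
        independent of the rest: \<open>e\<close> goes into the set and \<open>f\<close> stays
        out.\<close>
      have "\<forall>g\<in>E. (a g \<in> insert e (A - {f}) \<longleftrightarrow> g \<notin> insert e (A - {f})) \<and>
          (b g \<in> insert e (A - {f}) \<longleftrightarrow> g \<notin> insert e (A - {f}))"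
      proof
        fix g assume g: "g \<in> E"
        consider "g = e" | "g = f" | "g \<in> E - {e, f}" using g by blast
        then show "(a g \<in> insert e (A - {f}) \<longleftrightarrow> g \<notin> insert e (A - {f})) \<and>
          (b g \<in> insert e (A - {f}) \<longleftrightarrow> g \<notin> insert e (A - {f}))"
        proof cases
          case 3
          then show ?thesis using A a'[OF 3] b'[OF 3] by auto
        qed (use f f_def True bf in auto)
      qed
      then show ?thesis by blast
    next
      case False
      define e' f' where "e' = b e" and "f' = b f"
      have e': "e' \<in> E" "e' \<noteq> e" "e' \<noteq> f" "b e' = e" using b[OF e] False by (auto simp: e'_def)
      have f': "f' \<in> E" "f' \<noteq> f" "f' \<noteq> e" "b f' = f" "f' \<noteq> e'"
        using b[OF f(1)] b[OF e] False f by (auto simp: e'_def f'_def)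
      \<comment> \<open>The stretch \<open>e', e, f, f'\<close> of a cycle is shortcut by pairing
        \<open>e'\<close> directly with \<open>f'\<close>, so the cycle loses two elements and stays
        even.\<close>
      define b1 where "b1 = b(e' := f', f' := e')"
      have b': "b1 g \<in> E - {e, f} \<and> b1 g \<noteq> g \<and> b1 (b1 g) = g" if g: "g \<in> E - {e, f}" for g
      proof (cases "g = e' \<or> g = f'")
        case True
        then show ?thesis using e' f' by (auto simp: b1_def)
      next
        case 1: False
        have "b g \<noteq> e" "b g \<noteq> f" using 1 b[of g] g by (auto simp: e'_def f'_def)
        moreover have "b g \<noteq> e'" "b g \<noteq> f'" using g b[of g] e' f' by auto
        ultimately show ?thesis using 1 b[of g] g by (auto simp: b1_def)
      qed
      from psubset.IH[OF sub a' b'] obtain A where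
        A: "\<And>g. g \<in> E - {e, f} \<Longrightarrow> (a g \<in> A \<longleftrightarrow> g \<notin> A) \<and> (b1 g \<in> A \<longleftrightarrow> g \<notin> A)" by blast
      \<comment> \<open>\<open>e\<close> gets the colour opposite to \<open>e'\<close>, and
        \<open>f\<close> the colour of \<open>e'\<close>. Since \<open>b1\<close> pairs
        \<open>e'\<close> with \<open>f'\<close>, these two have opposite colours, so
        \<open>f\<close> also differs from \<open>f'\<close>.\<close>
      define B where "B = {g. if g = e then e' \<notin> A else if g = f then e' \<in> A else g \<in> A}"
      have B: "g \<in> B \<longleftrightarrow> g \<in> A" if "g \<in> E - {e, f}" for g using that by (auto simp: B_def)
      have eB: "e \<in> B \<longleftrightarrow> e' \<notin> A" "f \<in> B \<longleftrightarrow> e' \<in> A" using f by (auto simp: B_def)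
      have e'f': "f' \<in> A \<longleftrightarrow> e' \<notin> A" using A[of e'] e' f' by (auto simp: b1_def)
      have "(a g \<in> B \<longleftrightarrow> g \<notin> B) \<and> (b g \<in> B \<longleftrightarrow> g \<notin> B)" if g: "g \<in> E" for g
      proof -
        consider "g = e" | "g = f" | "g = e'" | "g = f'" | "g \<in> E - {e, f, e', f'}" using g by blast
        then show ?thesis
        proof cases
          case 1
          then show ?thesis using eB f_def B[of e'] e' by (auto simp: e'_def)
        next
          case 2
          then show ?thesis using eB f B[of f'] f' e'f' by (auto simp: f'_def)
        next
          case 3
          then show ?thesis using eB B[of e'] B[of "a e'"] a'[of e'] A[of e'] e' by auto
        next
          case 4
          then show ?thesis using eB B[of f'] B[of "a f'"] a'[of f'] A[of f'] f' e'f' by auto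
        next
          case 5
          then have "b1 g = b g" by (auto simp: b1_def)
          then show ?thesis using B[of g] B[of "a g"] B[of "b g"] a'[of g] b'[of g] A[of g] 5 by auto
        qed
      qed
      then show ?thesis by blast
    qed
  qed auto
qed

text \<open>A colouring that alternates along both pairings turns each pairing into a bijection
  between the two colour classes of every fibre.\<close>

lemma balanced_bipartition:
  assumes "finite E" "\<And>x. even (card {e \<in> E. s e = x})" "\<And>y. even (card {e \<in> E. t e = y})"
  obtains A where
    "\<And>x. card {e \<in> E. s e = x \<and> e \<in> A} = card {e \<in> E. s e = x \<and> e \<notin> A}"
    "\<And>y. card {e \<in> E. t e = y \<and> e \<in> A} = card {e \<in> E. t e = y \<and> e \<notin> A}"
proof -
  obtain a where a: "\<And>e. e \<in> E \<Longrightarrow> a e \<in> E \<and> a e \<noteq> e \<and> a (a e) = e \<and> s (a e) = s e"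
    using fibre_pairing[OF assms(1,2)] by blast
  obtain b where b: "\<And>e. e \<in> E \<Longrightarrow> b e \<in> E \<and> b e \<noteq> e \<and> b (b e) = e \<and> t (b e) = t e"
    using fibre_pairing[OF assms(1,3)] by blast
  obtain A where A: "\<forall>e\<in>E. (a e \<in> A \<longleftrightarrow> e \<notin> A) \<and> (b e \<in> A \<longleftrightarrow> e \<notin> A)"
    using two_pairings_alternating[OF assms(1), of a b] a b by blast
  show thesis
  proof
    show "card {e \<in> E. s e = x \<and> e \<in> A} = card {e \<in> E. s e = x \<and> e \<notin> A}" for x
      by (rule bij_betw_same_card[of a], rule bij_betw_byWitness[where f' = a]) (use A a in auto)
    show "card {e \<in> E. t e = y \<and> e \<in> A} = card {e \<in> E. t e = y \<and> e \<notin> A}" for y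
      by (rule bij_betw_same_card[of b], rule bij_betw_byWitness[where f' = b]) (use A b in auto)
  qed
qed

section \<open>A determinant recursion over the field with two elements\<close>

text \<open>For a symmetric matrix \<open>M\<close> over the field with two elements, with \<open>M'\<close> obtained by adding
  1 to the diagonal entry at \<open>a\<close> and \<open>M''\<close> by deleting row and column \<open>a\<close>, this is
  \<open>det M' = det M + det M''\<close>. All three kernels sit inside the space \<open>W\<close> of vectors \<open>X\<close> for which
  \<open>M X\<close> is supported on \<open>{a}\<close>. By symmetry the image of \<open>W\<close> under \<open>X \<mapsto> (X\<^sub>a, (M X)\<^sub>a)\<close> is at most
  one-dimensional, so either \<open>W\<close> is a line, which lies in exactly one of the kernels, or some
  nonzero vector lies in all of them.\<close>

lemma nonsingular_diagonal_update:
  fixes P :: "'v set \<Rightarrow> 'v \<Rightarrow> bool"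
  assumes S: "finite S" "a \<in> S"
    and add: "\<And>X Y v. X \<subseteq> S \<Longrightarrow> Y \<subseteq> S \<Longrightarrow> v \<in> S \<Longrightarrow> P (sym_diff X Y) v \<longleftrightarrow> P X v \<noteq> P Y v"
    and sym: "\<And>X Y. X \<subseteq> S \<Longrightarrow> Y \<subseteq> S \<Longrightarrow> odd (card {y \<in> Y. P X y}) \<longleftrightarrow> odd (card {x \<in> X. P Y x})"
  shows "(\<forall>X \<subseteq> S. (\<forall>v\<in>S. P X v \<longleftrightarrow> v = a \<and> a \<in> X) \<longrightarrow> X = {}) \<longleftrightarrow>
    (\<forall>X \<subseteq> S. (\<forall>v\<in>S. \<not> P X v) \<longrightarrow> X = {}) \<noteq>
    (\<forall>X \<subseteq> S - {a}. (\<forall>v\<in>S - {a}. \<not> P X v) \<longrightarrow> X = {})"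
proof -
  define W where "W = {X. X \<subseteq> S \<and> (\<forall>v\<in>S - {a}. \<not> P X v)}"
  have Wdiff: "sym_diff X Y \<in> W" if "X \<in> W" "Y \<in> W" for X Y
    using that add[of X Y] by (auto simp: W_def)
  have "\<exists>X\<in>W. X \<noteq> {}"
  proof -
    \<comment> \<open>\<open>W\<close> is cut out by one equation fewer than there are coordinates:
      two vectors with the same image under \<open>?f\<close> exist by counting, and their sum is
      the nonzero vector sought.\<close>
    let ?f = "\<lambda>X. {v \<in> S - {a}. P X v}"
    have "\<not> inj_on ?f (Pow S)"
    proof
      assume "inj_on ?f (Pow S)"
      then have "card (Pow S) \<le> card (Pow (S - {a}))"
        using S by (intro card_inj_on_le[of ?f]) auto
      moreover have "card (S - {a}) < card S" using S by (meson card_Diff1_less)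
      ultimately show False using S by (simp add: card_Pow)
    qed
    then obtain X Y where XY: "X \<subseteq> S" "Y \<subseteq> S" "X \<noteq> Y" "?f X = ?f Y" by (auto simp: inj_on_def)
    then have "P X v \<longleftrightarrow> P Y v" if "v \<in> S - {a}" for v using that by blast
    then have "sym_diff X Y \<in> W" using XY add[of X Y] by (auto simp: W_def)
    moreover have "sym_diff X Y \<noteq> {}" using XY by blast
    ultimately show ?thesis by (intro bexI)
  qed
  then obtain X0 where X0: "X0 \<in> W" "X0 \<noteq> {}" by blast
  have P_on_W: "{y \<in> Y. P X y} = (if a \<in> Y \<and> P X a then {a} else {})" if "X \<in> W" "Y \<in> W" for X Y
    using that by (auto simp: W_def)
  \<comment> \<open>On \<open>W\<close> both sides of the symmetry hypothesis have at most the term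
    at \<open>a\<close>. The result says that the pairs \<open>(a \<in> X, P X a)\<close> and
    \<open>(a \<in> Y, P Y a)\<close> have determinant 0.\<close>
  have sym_a: "(a \<in> Y \<and> P X a) \<longleftrightarrow> (a \<in> X \<and> P Y a)" if "X \<in> W" "Y \<in> W" for X Y
    using sym[of X Y] P_on_W[OF that] P_on_W[OF that(2,1)] that
    by (auto simp: W_def split: if_splits)
  have 1: "(\<forall>X \<subseteq> S. (\<forall>v\<in>S. \<not> P X v) \<longrightarrow> X = {}) \<longleftrightarrow> (\<forall>X\<in>W. \<not> P X a \<longrightarrow> X = {})"
    using S by (auto simp: W_def)
  have 2: "(\<forall>X \<subseteq> S. (\<forall>v\<in>S. P X v \<longleftrightarrow> v = a \<and> a \<in> X) \<longrightarrow> X = {}) \<longleftrightarrow>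
      (\<forall>X\<in>W. (P X a \<longleftrightarrow> a \<in> X) \<longrightarrow> X = {})"
  proof -
    have "(\<forall>v\<in>S. P X v \<longleftrightarrow> v = a \<and> a \<in> X) \<longleftrightarrow> (\<forall>v\<in>S - {a}. \<not> P X v) \<and> (P X a \<longleftrightarrow> a \<in> X)" for X
      using S(2) by auto
    then show ?thesis unfolding W_def by blast
  qed
  have 3: "(\<forall>X \<subseteq> S - {a}. (\<forall>v\<in>S - {a}. \<not> P X v) \<longrightarrow> X = {}) \<longleftrightarrow> (\<forall>X\<in>W. a \<notin> X \<longrightarrow> X = {})"
    by (auto simp: W_def)
  show ?thesis
  proof (cases "\<exists>Z\<in>W. Z \<noteq> {} \<and> a \<notin> Z \<and> \<not> P Z a")
    \<comment> \<open>Such a \<open>Z\<close> lies in all three kernels, so all three conditions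
      fail.\<close>
    case True
    then show ?thesis unfolding 1 2 3 by blast
  next
    case False
    \<comment> \<open>Both vectors have nonzero pairs, and by \<open>sym_a\<close> these are
      linearly dependent, hence equal over two elements. Their sum then has pair zero, so it
      vanishes by the case assumption.\<close>
    have "X = X0" if X: "X \<in> W" "X \<noteq> {}" for X
    proof (rule ccontr)
      assume "X \<noteq> X0"
      define Z where "Z = sym_diff X X0"
      have "Z \<noteq> {}" "Z \<in> W" using \<open>X \<noteq> X0\<close> Wdiff[OF X(1) X0(1)] by (auto simp: Z_def)
      then have "a \<in> Z \<or> P Z a" using False by blast
      moreover have "P Z a \<longleftrightarrow> P X a \<noteq> P X0 a"
        using add[of X X0 a] X(1) X0(1) S(2) unfolding Z_def W_def by blast
      moreover have "a \<in> Z \<longleftrightarrow> (a \<in> X) \<noteq> (a \<in> X0)" by (auto simp: Z_def)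
      moreover have "a \<in> X \<or> P X a" "a \<in> X0 \<or> P X0 a" using False X X0 by blast+
      ultimately show False using sym_a[OF X(1) X0(1)] by argo
    qed
    then have W: "(\<forall>X\<in>W. Q X \<longrightarrow> X = {}) \<longleftrightarrow> \<not> Q X0" for Q using X0 by metis
    \<comment> \<open>Now \<open>X0\<close> is the only nonzero vector of \<open>W\<close>, and the
      three conditions become \<open>P X0 a \<noteq> (a \<in> X0)\<close>, \<open>P X0 a\<close> and
      \<open>a \<in> X0\<close>.\<close>
    have "a \<in> X0 \<or> P X0 a" using False X0 by blast
    then show ?thesis unfolding 1 2 3 W by argo
  qed
qed

section \<open>The Laplacian modulo 2\<close>

text \<open>For edges with two ends this is the usual cut between \<open>X\<close> and its
  complement; the formulation by parity makes it additive in \<open>X\<close>.\<close>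

definition cut_edges :: "('e \<Rightarrow> 'v set) \<Rightarrow> 'e set \<Rightarrow> 'v set \<Rightarrow> 'e set" where
  "cut_edges ends E X = {e \<in> E. odd (card (ends e \<inter> X))}"

text \<open>The entry at \<open>v\<close> of the Laplacian applied to the indicator vector of \<open>X\<close>, modulo 2.\<close>

definition odd_cut_degree :: "('e \<Rightarrow> 'v set) \<Rightarrow> 'e set \<Rightarrow> 'v set \<Rightarrow> 'v \<Rightarrow> bool" where
  "odd_cut_degree ends E X v \<longleftrightarrow> odd (card {e \<in> cut_edges ends E X. v \<in> ends e})"

text \<open>This concerns the principal submatrix indexed by \<open>S\<close>, stated through its
  kernel instead of a determinant. It holds for \<open>S = {}\<close>, in line with determinant 1 of
  the empty matrix.\<close>

definition laplacian_nonsingular :: "('e \<Rightarrow> 'v set) \<Rightarrow> 'e set \<Rightarrow> 'v set \<Rightarrow> bool" where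
  "laplacian_nonsingular ends E S \<longleftrightarrow>
    (\<forall>X \<subseteq> S. (\<forall>v\<in>S. \<not> odd_cut_degree ends E X v) \<longrightarrow> X = {})"

lemma cut_edges_sym_diff:
  assumes "\<And>e. e \<in> E \<Longrightarrow> finite (ends e)"
  shows "cut_edges ends E (sym_diff X Y) = sym_diff (cut_edges ends E X) (cut_edges ends E Y)"
proof -
  have "odd (card (ends e \<inter> sym_diff X Y)) \<longleftrightarrow>
      odd (card (ends e \<inter> X)) \<noteq> odd (card (ends e \<inter> Y))" if "e \<in> E" for e
  proof -
    have "ends e \<inter> sym_diff X Y = sym_diff (ends e \<inter> X) (ends e \<inter> Y)" by blast
    then show ?thesis using odd_card_sym_diff[of "ends e \<inter> X" "ends e \<inter> Y"] assms[OF that] by simp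
  qed
  then show ?thesis unfolding cut_edges_def by blast
qed

lemma odd_cut_degree_sym_diff:
  assumes "finite E" "\<And>e. e \<in> E \<Longrightarrow> finite (ends e)"
  shows "odd_cut_degree ends E (sym_diff X Y) v \<longleftrightarrow>
    odd_cut_degree ends E X v \<noteq> odd_cut_degree ends E Y v"
proof -
  let ?D = "\<lambda>X. {e \<in> cut_edges ends E X. v \<in> ends e}"
  have "?D (sym_diff X Y) = sym_diff (?D X) (?D Y)"
    using cut_edges_sym_diff[of E ends X Y, OF assms(2)] by blast
  moreover have "finite (?D X)" "finite (?D Y)" using assms by (auto simp: cut_edges_def)
  ultimately show ?thesis unfolding odd_cut_degree_def using odd_card_sym_diff by simp
qed

text \<open>The left side is the bilinear form of the Laplacian at \<open>X\<close> and
  \<open>Y\<close>. Counting pairs of a vertex in \<open>Y\<close> and a cut edge of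
  \<open>X\<close> at it in two ways gives an expression symmetric in \<open>X\<close> and
  \<open>Y\<close>.\<close>

lemma odd_card_odd_cut_degree:
  assumes "finite E" "finite Y"
  shows "odd (card {y \<in> Y. odd_cut_degree ends E X y}) \<longleftrightarrow>
    odd (card (cut_edges ends E X \<inter> cut_edges ends E Y))"
proof -
  let ?C = "cut_edges ends E X"
  have fin: "finite ?C" using assms by (simp add: cut_edges_def)
  have "(\<Sum>y\<in>Y. card {e \<in> ?C. y \<in> ends e}) = (\<Sum>e\<in>?C. card (ends e \<inter> Y))"
    using sum_multicount_gen[OF assms(2) fin, of "\<lambda>y e. y \<in> ends e" "\<lambda>e. card (ends e \<inter> Y)"]
    by (simp add: Int_def conj_commute)
  moreover have "even (\<Sum>y\<in>Y. card {e \<in> ?C. y \<in> ends e}) \<longleftrightarrow>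
      even (card {y \<in> Y. odd_cut_degree ends E X y})"
    using assms by (simp add: even_sum_iff odd_cut_degree_def)
  moreover have "even (\<Sum>e\<in>?C. card (ends e \<inter> Y)) \<longleftrightarrow> even (card (?C \<inter> cut_edges ends E Y))"
  proof -
    have "{e \<in> ?C. odd (card (ends e \<inter> Y))} = ?C \<inter> cut_edges ends E Y"
      by (auto simp: cut_edges_def)
    then show ?thesis using fin by (simp add: even_sum_iff)
  qed
  ultimately show ?thesis by simp
qed

text \<open>Since \<open>r\<close> is outside \<open>S\<close>, the edge \<open>e\<close> affects
  only the diagonal entry at \<open>a\<close> of the Laplacian restricted to
  \<open>S\<close>.\<close>

lemma odd_cut_degree_insert:
  assumes "finite E" "e \<notin> E" "ends e = {r, a}" "r \<notin> S" "a \<in> S" "X \<subseteq> S" "v \<in> S"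
  shows "odd_cut_degree ends (insert e E) X v \<longleftrightarrow>
    odd_cut_degree ends E X v \<noteq> (v = a \<and> a \<in> X)"
proof -
  let ?D = "\<lambda>E. {f \<in> cut_edges ends E X. v \<in> ends f}"
  have "ends e \<inter> X = (if a \<in> X then {a} else {})" using assms by auto
  then have "odd (card (ends e \<inter> X)) \<longleftrightarrow> a \<in> X" by simp
  then have "?D (insert e E) = (if v = a \<and> a \<in> X then insert e (?D E) else ?D E)"
    using assms by (auto simp: cut_edges_def)
  moreover have "e \<notin> ?D E" "finite (?D E)" using assms by (auto simp: cut_edges_def)
  ultimately have "card (?D (insert e E)) = (if v = a \<and> a \<in> X then Suc (card (?D E)) else card (?D E))"
    by (metis card_insert_disjoint)
  then show ?thesis by (simp add: odd_cut_degree_def)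
qed

text \<open>Adding \<open>e\<close> adds 1 to a single diagonal entry, so
  \<open>nonsingular_diagonal_update\<close> applies; its symmetry hypothesis comes from
  \<open>odd_card_odd_cut_degree\<close>.\<close>

lemma laplacian_nonsingular_insert:
  assumes "finite E" "\<And>f. f \<in> E \<Longrightarrow> finite (ends f)" "finite S"
    and "e \<notin> E" "ends e = {r, a}" "r \<notin> S" "a \<in> S"
  shows "laplacian_nonsingular ends (insert e E) S \<longleftrightarrow>
    laplacian_nonsingular ends E S \<noteq> laplacian_nonsingular ends E (S - {a})"
proof -
  have "laplacian_nonsingular ends (insert e E) S \<longleftrightarrow>
      (\<forall>X \<subseteq> S. (\<forall>v\<in>S. odd_cut_degree ends E X v \<longleftrightarrow> v = a \<and> a \<in> X) \<longrightarrow> X = {})"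
    unfolding laplacian_nonsingular_def
    using odd_cut_degree_insert[of E e ends r a S] assms by auto
  also have "\<dots> \<longleftrightarrow> laplacian_nonsingular ends E S \<noteq> laplacian_nonsingular ends E (S - {a})"
    unfolding laplacian_nonsingular_def
  proof (rule nonsingular_diagonal_update)
    fix X Y assume "X \<subseteq> S" "Y \<subseteq> S"
    then have "finite X" "finite Y" using assms(3) finite_subset by auto
    then show "odd (card {y \<in> Y. odd_cut_degree ends E X y}) \<longleftrightarrow>
        odd (card {x \<in> X. odd_cut_degree ends E Y x})"
      using assms(1) by (simp add: odd_card_odd_cut_degree Int_commute)
  qed (use assms odd_cut_degree_sym_diff[of E ends] in auto)
  finally show ?thesis .
qed

section \<open>Reachability and deletion-contraction for rooted forests\<close>

definition edge_rel :: "('e \<Rightarrow> 'v set) \<Rightarrow> 'e set \<Rightarrow> ('v \<times> 'v) set" where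
  "edge_rel ends T = {(u, v). \<exists>e\<in>T. ends e = {u, v}}"

lemma sym_edge_rel: "sym (edge_rel ends T)"
  by (auto simp: sym_def edge_rel_def insert_commute)

lemma edge_rel_mono: "S \<subseteq> T \<Longrightarrow> edge_rel ends S \<subseteq> edge_rel ends T"
  by (auto simp: edge_rel_def)

lemma edge_rel_rtrancl_sym:
  "(u, v) \<in> (edge_rel ends T)\<^sup>* \<Longrightarrow> (v, u) \<in> (edge_rel ends T)\<^sup>*"
  using sym_rtrancl[OF sym_edge_rel] by (meson symD)

text \<open>Starting from \<open>R\<close>, the edge \<open>e\<close> can only help to get to
  \<open>a\<close>, so it becomes dispensable once \<open>a\<close> is itself a root. This is
  contraction of \<open>e\<close> in terms of root sets.\<close>

lemma reachable_remove_edge: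
  assumes "e \<in> T" "ends e = {r, a}" "r \<in> R"
  shows "(edge_rel ends T)\<^sup>* `` R = (edge_rel ends (T - {e}))\<^sup>* `` insert a R"
proof
  show "(edge_rel ends T)\<^sup>* `` R \<subseteq> (edge_rel ends (T - {e}))\<^sup>* `` insert a R"
  proof
    fix v assume "v \<in> (edge_rel ends T)\<^sup>* `` R"
    then obtain u where "u \<in> R" "(u, v) \<in> (edge_rel ends T)\<^sup>*" by blast
    from this(2,1) show "v \<in> (edge_rel ends (T - {e}))\<^sup>* `` insert a R"
    proof (induction rule: rtrancl_induct)
      case (step y z)
      from step.hyps(2) obtain f where f: "f \<in> T" "ends f = {y, z}" by (auto simp: edge_rel_def)
      show ?case
      proof (cases "f = e")
        case True
        \<comment> \<open>A walk that uses \<open>e\<close> arrives at \<open>r\<close> or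
          \<open>a\<close>, both of them roots, and can be restarted there.\<close>
        then have "z \<in> insert a R" using f assms by (auto simp: doubleton_eq_iff)
        then show ?thesis by blast
      next
        case False
        then have "(y, z) \<in> edge_rel ends (T - {e})" using f by (auto simp: edge_rel_def)
        then show ?thesis using step by (meson Image_iff rtrancl.rtrancl_into_rtrancl)
      qed
    qed auto
  qed
  have ra: "(r, a) \<in> edge_rel ends T" using assms by (auto simp: edge_rel_def)
  have "(edge_rel ends (T - {e}))\<^sup>* \<subseteq> (edge_rel ends T)\<^sup>*"
    by (intro rtrancl_mono edge_rel_mono) auto
  then show "(edge_rel ends (T - {e}))\<^sup>* `` insert a R \<subseteq> (edge_rel ends T)\<^sup>* `` R"
    using assms(3) converse_rtrancl_into_rtrancl[OF ra] by blast
qed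

text \<open>If no edge led from \<open>R\<close> to \<open>V - R\<close>, every walk starting in
  \<open>R\<close> would stay in \<open>R\<close>.\<close>

lemma crossing_edge:
  assumes "V \<subseteq> (edge_rel ends T)\<^sup>* `` R" "\<not> V \<subseteq> R" "\<And>e. e \<in> T \<Longrightarrow> ends e \<subseteq> V"
  obtains e r a where "e \<in> T" "ends e = {r, a}" "r \<in> R" "a \<in> V - R"
proof -
  have "v \<in> R" if none: "\<not> (\<exists>e r a. e \<in> T \<and> ends e = {r, a} \<and> r \<in> R \<and> a \<in> V - R)"
    and "u \<in> R" "(u, v) \<in> (edge_rel ends T)\<^sup>*" for u v
    using that(3,2)
  proof (induction rule: rtrancl_induct)
    case (step y z)
    from step.hyps(2) obtain f where f: "f \<in> T" "ends f = {y, z}" by (auto simp: edge_rel_def)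
    with assms(3) have "z \<in> V" by blast
    then show ?case using none f step by blast
  qed
  moreover have "\<exists>v u. u \<in> R \<and> v \<notin> R \<and> (u, v) \<in> (edge_rel ends T)\<^sup>*" using assms(1,2) by blast
  ultimately show thesis using that by metis
qed

text \<open>The forest grows greedily: a crossing edge is chosen, its far end joins the roots, and
  the remaining edges are treated in the same way. Each chosen edge accounts for one vertex outside
  \<open>R\<close>.\<close>

lemma exists_forest:
  assumes "finite T" "finite V" "\<And>e. e \<in> T \<Longrightarrow> ends e \<subseteq> V" "V \<subseteq> (edge_rel ends T)\<^sup>* `` R"
  shows "\<exists>F \<subseteq> T. card F = card (V - R) \<and> V \<subseteq> (edge_rel ends F)\<^sup>* `` R"
  using assms
proof (induction T arbitrary: R rule: finite_psubset_induct)
  case (psubset T)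
  show ?case
  proof (cases "V \<subseteq> R")
    case True
    then show ?thesis by (intro exI[of _ "{}"]) (auto simp: Diff_eq_empty_iff[THEN iffD2])
  next
    case False
    obtain e r a where e: "e \<in> T" "ends e = {r, a}" "r \<in> R" "a \<in> V - R"
      using crossing_edge[OF psubset.prems(3) False psubset.prems(2)] by blast
    from psubset.IH[of "T - {e}" "insert a R"] obtain F where F: "F \<subseteq> T - {e}"
      "card F = card (V - insert a R)" "V \<subseteq> (edge_rel ends F)\<^sup>* `` insert a R"
      using e psubset.prems reachable_remove_edge[of e T ends r a R] by auto
    have "insert e F - {e} = F" using F(1) by blast
    then have "V \<subseteq> (edge_rel ends (insert e F))\<^sup>* `` R"
      using F(3) e reachable_remove_edge[of e "insert e F" ends r a R] by simp
    moreover have "card (insert e F) = card (V - R)"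
    proof -
      have "V - R = insert a (V - insert a R)" using e by auto
      then have "card (V - R) = Suc (card (V - insert a R))"
        using psubset.prems(1) by (metis Diff_iff card_insert_disjoint finite_Diff insertI1)
      moreover have "finite F" "e \<notin> F" using F(1) psubset.hyps by (auto intro: finite_subset)
      ultimately show ?thesis using F by simp
    qed
    ultimately show ?thesis using F e by (intro exI[of _ "insert e F"]) auto
  qed
qed

text \<open>For \<open>R \<noteq> {}\<close> these are the edge sets of the spanning trees of the graph with \<open>R\<close>
  contracted to one vertex.\<close>

definition rooted_forests :: "'v set \<Rightarrow> ('e \<Rightarrow> 'v set) \<Rightarrow> 'e set \<Rightarrow> 'v set \<Rightarrow> 'e set set" where
  "rooted_forests V ends E R =
    {T. T \<subseteq> E \<and> card T = card (V - R) \<and> V \<subseteq> (edge_rel ends T)\<^sup>* `` R}"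

lemma finite_rooted_forests: "finite E \<Longrightarrow> finite (rooted_forests V ends E R)"
  by (rule finite_subset[of _ "Pow E"]) (auto simp: rooted_forests_def)

text \<open>The forests avoiding \<open>e\<close> are those of \<open>E\<close>; from the others,
  deleting \<open>e\<close> and making \<open>a\<close> a root preserves reachability and lowers
  both cardinalities by one.\<close>

lemma card_rooted_forests_insert:
  assumes "finite E" "finite V" "e \<notin> E" "ends e = {r, a}" "r \<in> R" "a \<in> V - R"
  shows "card (rooted_forests V ends (insert e E) R) =
    card (rooted_forests V ends E R) + card (rooted_forests V ends E (insert a R))"
proof -
  have cV: "card (V - R) = Suc (card (V - insert a R))"
  proof -
    have "V - R = insert a (V - insert a R)" using assms by auto
    then show ?thesis using assms(2) by (metis Diff_iff card_insert_disjoint finite_Diff insertI1)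
  qed
  have reach: "(edge_rel ends (insert e T))\<^sup>* `` R = (edge_rel ends T)\<^sup>* `` insert a R" if "e \<notin> T" for T
    using reachable_remove_edge[of e "insert e T" ends r a R] that assms by simp
  have ins: "insert e T \<in> rooted_forests V ends (insert e E) R \<longleftrightarrow>
      T \<in> rooted_forests V ends E (insert a R)" if "T \<subseteq> E" for T
  proof -
    have "e \<notin> T" "finite T" using that assms finite_subset by auto
    then show ?thesis using that reach[of T] cV by (auto simp: rooted_forests_def)
  qed
  have "rooted_forests V ends (insert e E) R =
      rooted_forests V ends E R \<union> insert e ` rooted_forests V ends E (insert a R)" (is "?L = ?A \<union> ?B")
  proof
    show "?L \<subseteq> ?A \<union> ?B"
    proof
      fix T assume T: "T \<in> ?L"
      show "T \<in> ?A \<union> ?B"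
      proof (cases "e \<in> T")
        case True
        then have "T = insert e (T - {e})" "T - {e} \<subseteq> E" using T by (auto simp: rooted_forests_def)
        then show ?thesis using ins[of "T - {e}"] T by (metis UnI2 image_eqI)
      qed (use T in \<open>auto simp: rooted_forests_def\<close>)
    qed
    show "?A \<union> ?B \<subseteq> ?L" using ins by (auto simp: rooted_forests_def)
  qed
  moreover have "?A \<inter> ?B = {}" using assms(3) by (auto simp: rooted_forests_def)
  moreover have "card ?B = card (rooted_forests V ends E (insert a R))"
    using assms(3) by (intro card_image inj_onI) (auto simp: rooted_forests_def insert_ident subset_iff)
  ultimately show ?thesis
    using assms(1) by (simp add: card_Un_disjoint finite_rooted_forests)
qed

section \<open>The matrix-tree theorem modulo 2\<close>

text \<open>Both sides obey the same recursion for an edge between \<open>R\<close> and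
  \<open>V - R\<close>; \<open>R\<close> is generalised because the recursion enlarges it. Without
  such an edge, both sides are true if \<open>V \<subseteq> R\<close> and false otherwise.\<close>

lemma odd_card_rooted_forests:
  assumes "finite E" "finite V" "\<And>e. e \<in> E \<Longrightarrow> ends e \<subseteq> V" "\<And>e. e \<in> E \<Longrightarrow> card (ends e) = 2"
  shows "odd (card (rooted_forests V ends E R)) \<longleftrightarrow> laplacian_nonsingular ends E (V - R)"
  using assms
proof (induction E arbitrary: R rule: finite_psubset_induct)
  case (psubset E)
  show ?case
  proof (cases "\<exists>e r a. e \<in> E \<and> ends e = {r, a} \<and> r \<in> R \<and> a \<in> V - R")
    case True
    then obtain e r a where e: "e \<in> E" "ends e = {r, a}" "r \<in> R" "a \<in> V - R" by blast
    define E' where "E' = E - {e}"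
    have E': "E = insert e E'" "e \<notin> E'" "E' \<subset> E" "finite E'"
      using e psubset.hyps by (auto simp: E'_def)
    have fin: "finite (ends f)" if "f \<in> E'" for f
      using psubset.prems(1,2) that E'(3) finite_subset by blast
    have IH: "odd (card (rooted_forests V ends E' R)) \<longleftrightarrow> laplacian_nonsingular ends E' (V - R)" for R
      using psubset.IH[OF E'(3)] psubset.prems E'(3) by blast
    have "V - insert a R = V - R - {a}" by auto
    then show ?thesis
      unfolding E'(1) using e E' fin psubset.prems(1) IH[of R] IH[of "insert a R"]
      by (subst card_rooted_forests_insert[where r = r and a = a])
        (auto simp: laplacian_nonsingular_insert[where r = r and a = a])
  next
    case none: False
    show ?thesis
    proof (cases "V \<subseteq> R")
      case True
      then have VR: "V - R = {}" by auto
      have "rooted_forests V ends E R = {{}}"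
        using True finite_subset[OF _ psubset.hyps] by (auto simp: rooted_forests_def VR)
      then show ?thesis by (simp add: VR laplacian_nonsingular_def)
    next
      case False
      have "rooted_forests V ends E R = {}"
      proof (rule equals0I)
        fix T assume T: "T \<in> rooted_forests V ends E R"
        then have T: "T \<subseteq> E" "V \<subseteq> (edge_rel ends T)\<^sup>* `` R" by (auto simp: rooted_forests_def)
        then show False
          using crossing_edge[OF T(2) False] psubset.prems(2) none by (metis subsetD)
      qed
      moreover have "\<not> laplacian_nonsingular ends E (V - R)"
      proof -
        \<comment> \<open>No edge joins \<open>R\<close> to \<open>V - R\<close>, so the nonempty
          set \<open>V - R\<close> itself is a kernel vector.\<close>
        have "even (card (ends e \<inter> (V - R)))" if e: "e \<in> E" for e
        proof -
          obtain x y where xy: "ends e = {x, y}" "x \<noteq> y"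
            using psubset.prems(3)[OF e] by (auto simp: card_2_iff)
          have "x \<in> V" "y \<in> V" using xy psubset.prems(2)[OF e] by auto
          moreover have "x \<in> R \<longleftrightarrow> y \<in> R"
            using none e xy calculation by (metis DiffI insert_commute)
          ultimately have "ends e \<inter> (V - R) = (if x \<in> R then {} else ends e)" using xy by auto
          then show ?thesis using psubset.prems(3)[OF e] by simp
        qed
        then have "cut_edges ends E (V - R) = {}" by (auto simp: cut_edges_def)
        then have "\<not> odd_cut_degree ends E (V - R) v" for v by (simp add: odd_cut_degree_def)
        then show ?thesis using False unfolding laplacian_nonsingular_def by blast
      qed
      ultimately show ?thesis by simp
    qed
  qed
qed

section \<open>Spanning trees as rooted forests\<close>

text \<open>When a path is extended by a vertex already on it, it is cut off at that vertex
  instead.\<close>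

lemma simple_path:
  assumes "(u, v) \<in> (edge_rel ends T)\<^sup>*"
  shows "\<exists>vs. vs \<noteq> [] \<and> hd vs = u \<and> last vs = v \<and> distinct vs \<and>
    (\<forall>i. Suc i < length vs \<longrightarrow> (vs ! i, vs ! Suc i) \<in> edge_rel ends T)"
  using assms
proof (induction rule: rtrancl_induct)
  case base
  show ?case by (intro exI[of _ "[u]"]) auto
next
  case (step y z)
  then obtain vs where vs: "vs \<noteq> []" "hd vs = u" "last vs = y" "distinct vs"
    "\<And>i. Suc i < length vs \<Longrightarrow> (vs ! i, vs ! Suc i) \<in> edge_rel ends T" by blast
  show ?case
  proof (cases "z \<in> set vs")
    case True
    then obtain xs ys where xs: "vs = xs @ z # ys" by (meson split_list)
    have "((xs @ [z]) ! i, (xs @ [z]) ! Suc i) \<in> edge_rel ends T" if "Suc i < length (xs @ [z])" for i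
      using that vs(5)[of i] by (auto simp: xs nth_append split: if_splits)
    moreover have "hd (xs @ [z]) = u" using vs(2) by (cases xs) (auto simp: xs)
    moreover have "distinct (xs @ [z])" using vs(4) by (simp add: xs)
    ultimately show ?thesis by (intro exI[of _ "xs @ [z]"]) auto
  next
    case False
    have "((vs @ [z]) ! i, (vs @ [z]) ! Suc i) \<in> edge_rel ends T" if "Suc i < length (vs @ [z])" for i
    proof (cases "Suc i < length vs")
      case True
      then show ?thesis using vs(5) by (simp add: nth_append)
    next
      case False
      then have "i = length vs - 1" "Suc i = length vs" using that vs(1) by auto
      then show ?thesis using step.hyps(2) vs(1,3) by (simp add: nth_append last_conv_nth)
    qed
    then show ?thesis using vs False by (intro exI[of _ "vs @ [z]"]) auto
  qed
qed

context multigraph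
begin

lemma connected_restrict_iff:
  assumes "r \<in> mverts G"
  shows "mg_connected (G\<lparr>medges := T\<rparr>) \<longleftrightarrow> mverts G \<subseteq> (edge_rel (mends G) T)\<^sup>* `` {r}"
proof -
  have adj: "mg_adj (G\<lparr>medges := T\<rparr>) = edge_rel (mends G) T"
    by (simp add: mg_adj_def edge_rel_def)
  have "(u, v) \<in> (edge_rel (mends G) T)\<^sup>*"
    if "(r, u) \<in> (edge_rel (mends G) T)\<^sup>*" "(r, v) \<in> (edge_rel (mends G) T)\<^sup>*" for u v
    using edge_rel_rtrancl_sym[OF that(1)] that(2) by (rule rtrancl_trans)
  then show ?thesis using assms by (auto simp: mg_connected_def adj)
qed

lemma cycle_remove_edge:
  assumes T: "T \<subseteq> medges G" and cyc: "mg_cycle (G\<lparr>medges := T\<rparr>) vs es"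
  obtains e where "e \<in> T" "(edge_rel (mends G) T)\<^sup>* \<subseteq> (edge_rel (mends G) (T - {e}))\<^sup>*"
proof -
  let ?n = "length vs"
  note c = cyc[unfolded mg_cycle_def, simplified]
  have n: "?n > 0" using c by auto
  \<comment> \<open>This is the edge closing the cycle, from the last vertex back to
    \<open>vs ! 0\<close>. The other edges of the cycle still connect its ends.\<close>
  define e where "e = es ! (?n - 1)"
  have nth: "es ! i \<in> T" if "i < ?n" for i using c that nth_mem[of i es] by auto
  have e: "e \<in> T" using nth[of "?n - 1"] n by (simp add: e_def)
  have ends: "mends G e = {vs ! (?n - 1), vs ! 0}" using c n by (auto simp: e_def)
  let ?r = "(edge_rel (mends G) (T - {e}))\<^sup>*"
  have "(vs ! 0, vs ! i) \<in> ?r" if "i < ?n" for i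
    using that
  proof (induction i)
    case (Suc i)
    have "es ! i \<noteq> e" using c Suc.prems nth_eq_iff_index_eq[of es i "?n - 1"] by (auto simp: e_def)
    moreover have "es ! i \<in> T" using nth[of i] Suc.prems by simp
    moreover have "mends G (es ! i) = {vs ! i, vs ! Suc i}" using c Suc.prems by auto
    ultimately have "(vs ! i, vs ! Suc i) \<in> edge_rel (mends G) (T - {e})"
      by (auto simp: edge_rel_def)
    then show ?case using Suc by (meson Suc_lessD rtrancl.rtrancl_into_rtrancl)
  qed simp
  then have 1: "(vs ! 0, vs ! (?n - 1)) \<in> ?r" using n by simp
  have "edge_rel (mends G) T \<subseteq> ?r"
  proof clarify
    fix u v assume "(u, v) \<in> edge_rel (mends G) T"
    then obtain f where f: "f \<in> T" "mends G f = {u, v}" by (auto simp: edge_rel_def)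
    show "(u, v) \<in> ?r"
    proof (cases "f = e")
      case True
      then show ?thesis using f ends 1 edge_rel_rtrancl_sym[OF 1] by (auto simp: doubleton_eq_iff)
    qed (use f in \<open>auto simp: edge_rel_def intro!: r_into_rtrancl\<close>)
  qed
  then have "(edge_rel (mends G) T)\<^sup>* \<subseteq> ?r" by (rule rtrancl_subset_rtrancl)
  then show thesis using that e by blast
qed

lemma path_and_edge_cycle:
  assumes T: "T \<subseteq> medges G" and e: "e \<in> T" "mends G e = {u, v}"
    and path: "(u, v) \<in> (edge_rel (mends G) (T - {e}))\<^sup>*"
  shows "\<exists>vs es. mg_cycle (G\<lparr>medges := T\<rparr>) vs es"
proof -
  obtain vs where vs: "vs \<noteq> []" "hd vs = u" "last vs = v" "distinct vs"
    "\<And>i. Suc i < length vs \<Longrightarrow> (vs ! i, vs ! Suc i) \<in> edge_rel (mends G) (T - {e})"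
    using simple_path[OF path] by blast
  have "\<exists>f. \<forall>i. Suc i < length vs \<longrightarrow> f i \<in> T - {e} \<and> mends G (f i) = {vs ! i, vs ! Suc i}"
    using vs(5) by (intro choice) (auto simp: edge_rel_def)
  then obtain f where f: "\<And>i. Suc i < length vs \<Longrightarrow> f i \<in> T - {e} \<and> mends G (f i) = {vs ! i, vs ! Suc i}"
    by blast
  \<comment> \<open>\<open>e\<close> is placed at index \<open>length vs - 1\<close>, where the
    successor index wraps around to 0.\<close>
  define es where "es = map f [0..<length vs - 1] @ [e]"
  have inj: "inj_on f {0..<length vs - 1}"
  proof (rule inj_onI)
    fix i j assume ij: "i \<in> {0..<length vs - 1}" "j \<in> {0..<length vs - 1}" "f i = f j"
    then have "{vs ! i, vs ! Suc i} = {vs ! j, vs ! Suc j}" using f[of i] f[of j] by auto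
    then show "i = j" using ij vs(4) by (auto simp: doubleton_eq_iff nth_eq_iff_index_eq)
  qed
  have V: "set vs \<subseteq> mverts G"
  proof
    fix x assume "x \<in> set vs"
    then obtain i where i: "i < length vs" "x = vs ! i" by (auto simp: in_set_conv_nth)
    show "x \<in> mverts G"
    proof (cases "Suc i < length vs")
      case True
      then show ?thesis using f[OF True] i T mends_subset[of "f i"] by auto
    next
      case False
      then have "length vs - 1 = i" using i by simp
      then have "x = v" using i vs(1,3) by (simp add: last_conv_nth)
      then show ?thesis using e T mends_subset[of e] by auto
    qed
  qed
  have "mends G (es ! i) = {vs ! i, vs ! (Suc i mod length vs)}" if "i < length vs" for i
  proof (cases "Suc i < length vs")
    case True
    then have "i < length vs - 1" by simp
    then have "es ! i = f i" by (simp add: es_def nth_append)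
    then show ?thesis using f[OF True] True by simp
  next
    case False
    then have "i = length vs - 1" "Suc i = length vs" using that by auto
    then have "es ! i = e" "vs ! i = v" "vs ! (Suc i mod length vs) = u"
      using vs(1-3) by (simp_all add: es_def nth_append last_conv_nth hd_conv_nth)
    then show ?thesis using e by (simp add: insert_commute)
  qed
  moreover have "distinct es"
  proof -
    have "f i \<noteq> e" if "i < length vs - 1" for i using f[of i] that by auto
    then have "e \<notin> f ` {0..<length vs - 1}" by force
    then show ?thesis using inj by (simp add: es_def distinct_map)
  qed
  moreover have "set es \<subseteq> T" using f e by (auto simp: es_def)
  moreover have "length es = length vs" using vs(1) by (cases vs) (auto simp: es_def)
  ultimately have "mg_cycle (G\<lparr>medges := T\<rparr>) vs es" using vs V by (simp add: mg_cycle_def)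
  then show ?thesis by blast
qed

lemma spanning_trees_eq_rooted_forests:
  assumes r: "r \<in> mverts G"
  shows "spanning_trees G = rooted_forests (mverts G) (mends G) (medges G) {r}"
proof -
  let ?V = "mverts G" and ?c = "\<lambda>T. mverts G \<subseteq> (edge_rel (mends G) T)\<^sup>* `` {r}"
  have forest: "\<exists>F \<subseteq> T. card F = card (?V - {r}) \<and> ?c F" if "T \<subseteq> medges G" "?c T" for T
    using that finite_subset[OF that(1) finite_medges] finite_mverts mends_subset
    by (intro exists_forest) auto
  have "(\<nexists>vs es. mg_cycle (G\<lparr>medges := T\<rparr>) vs es) \<longleftrightarrow> card T = card (?V - {r})"
    if T: "T \<subseteq> medges G" "?c T" for T
  proof
    have finT: "finite T" using T finite_medges finite_subset by blast
    show "card T = card (?V - {r})" if acyc: "\<nexists>vs es. mg_cycle (G\<lparr>medges := T\<rparr>) vs es"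
    proof (rule ccontr)
      assume ne: "card T \<noteq> card (?V - {r})"
      obtain F where F: "F \<subseteq> T" "card F = card (?V - {r})" "?c F" using forest[OF T] by blast
      then have "F \<noteq> T" using ne by auto
      then obtain e where e: "e \<in> T" "e \<notin> F" using F(1) by blast
      obtain u v where uv: "mends G e = {u, v}" using card_mends[of e] e T by (auto simp: card_2_iff)
      then have "u \<in> ?V" "v \<in> ?V" using mends_subset[of e] e T by auto
      then have "(r, u) \<in> (edge_rel (mends G) F)\<^sup>*" "(r, v) \<in> (edge_rel (mends G) F)\<^sup>*"
        using F by auto
      then have "(u, v) \<in> (edge_rel (mends G) F)\<^sup>*" by (meson edge_rel_rtrancl_sym rtrancl_trans)
      moreover have "(edge_rel (mends G) F)\<^sup>* \<subseteq> (edge_rel (mends G) (T - {e}))\<^sup>*"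
        using F e by (intro rtrancl_mono edge_rel_mono) auto
      ultimately show False using path_and_edge_cycle[OF T(1) e(1) uv] acyc by blast
    qed
    show "\<nexists>vs es. mg_cycle (G\<lparr>medges := T\<rparr>) vs es" if card: "card T = card (?V - {r})"
    proof
      assume "\<exists>vs es. mg_cycle (G\<lparr>medges := T\<rparr>) vs es"
      then obtain e where e: "e \<in> T" "(edge_rel (mends G) T)\<^sup>* \<subseteq> (edge_rel (mends G) (T - {e}))\<^sup>*"
        using cycle_remove_edge[OF T(1)] by metis
      then have "?c (T - {e})" using T by blast
      then obtain F where F: "F \<subseteq> T - {e}" "card F = card (?V - {r})" using forest[of "T - {e}"] T by blast
      have "card F \<le> card (T - {e})" using F finT by (intro card_mono) auto
      also have "\<dots> < card T" using e finT by (meson card_Diff1_less)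
      finally show False using F card by simp
    qed
  qed
  then show ?thesis
    using connected_restrict_iff[OF r] by (auto simp: spanning_trees_def mg_tree_def rooted_forests_def)
qed

section \<open>Eulerian cuts as kernel vectors\<close>

lemma edge_other_end:
  assumes "e \<in> medges G" "x \<in> mends G e"
  obtains y where "mends G e = {x, y}"
proof -
  obtain u v where "mends G e = {u, v}" using card_mends[OF assms(1)] by (auto simp: card_2_iff)
  then show thesis using assms(2) that[of u] that[of v] by (auto simp: insert_commute)
qed

lemma odd_card_ends_Int:
  assumes "e \<in> medges G" "mends G e = {x, y}"
  shows "odd (card (mends G e \<inter> X)) \<longleftrightarrow> (x \<in> X) \<noteq> (y \<in> X)"
proof -
  have "x \<noteq> y" using card_mends[OF assms(1)] assms(2) by auto
  then show ?thesis unfolding assms(2) by (cases "x \<in> X"; cases "y \<in> X") auto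
qed

lemma cut_degree_eq:
  assumes "X \<union> X' = mverts G" "X \<inter> X' = {}" "x \<in> mverts G"
  shows "{e \<in> cut_edges (mends G) (medges G) X. x \<in> mends G e} =
    {e \<in> medges G. \<exists>y \<in> (if x \<in> X then X' else X). mends G e = {x, y}}" (is "?L = ?R")
proof
  show "?L \<subseteq> ?R"
  proof
    fix e assume "e \<in> ?L"
    then have e: "e \<in> medges G" "odd (card (mends G e \<inter> X))" "x \<in> mends G e"
      by (auto simp: cut_edges_def)
    obtain y where y: "mends G e = {x, y}" using e(1,3) by (rule edge_other_end)
    have "y \<in> mverts G" using mends_subset[OF e(1)] y by auto
    then show "e \<in> ?R" using e y assms odd_card_ends_Int[OF e(1) y] by auto
  qed
  show "?R \<subseteq> ?L" using assms odd_card_ends_Int[where X = X] by (fastforce simp: cut_edges_def)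
qed

text \<open>At a vertex of either side, the edges to the other side are exactly the cut edges there,
  so both parity conditions say that the Laplacian annihilates \<open>X\<close> modulo 2.\<close>

lemma eulerian_cut_iff:
  "eulerian_cut G X X' \<longleftrightarrow> X \<noteq> {} \<and> X' \<noteq> {} \<and> X \<inter> X' = {} \<and> X \<union> X' = mverts G \<and>
    (\<forall>x \<in> mverts G. \<not> odd_cut_degree (mends G) (medges G) X x)"
proof -
  have "(\<forall>x \<in> X. even (card {e \<in> medges G. \<exists>y \<in> X'. mends G e = {x, y}})) \<and>
      (\<forall>x \<in> X'. even (card {e \<in> medges G. \<exists>y \<in> X. mends G e = {x, y}})) \<longleftrightarrow>
      (\<forall>x \<in> mverts G. \<not> odd_cut_degree (mends G) (medges G) X x)"
    if "X \<inter> X' = {}" "X \<union> X' = mverts G"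
  proof -
    have "\<not> odd_cut_degree (mends G) (medges G) X x \<longleftrightarrow>
        even (card {e \<in> medges G. \<exists>y \<in> X'. mends G e = {x, y}})" if "x \<in> X" for x
    proof -
      have "x \<in> mverts G" using that \<open>X \<union> X' = mverts G\<close> by auto
      then show ?thesis
        using cut_degree_eq[of X X' x] that \<open>X \<inter> X' = {}\<close> \<open>X \<union> X' = mverts G\<close>
        by (simp add: odd_cut_degree_def)
    qed
    moreover have "\<not> odd_cut_degree (mends G) (medges G) X x \<longleftrightarrow>
        even (card {e \<in> medges G. \<exists>y \<in> X. mends G e = {x, y}})" if "x \<in> X'" for x
    proof -
      have "x \<notin> X" "x \<in> mverts G" using that \<open>X \<inter> X' = {}\<close> \<open>X \<union> X' = mverts G\<close> by auto
      then show ?thesis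
        using cut_degree_eq[of X X' x] \<open>X \<inter> X' = {}\<close> \<open>X \<union> X' = mverts G\<close>
        by (simp add: odd_cut_degree_def)
    qed
    ultimately show ?thesis using that by blast
  qed
  then show ?thesis unfolding eulerian_cut_def by blast
qed

lemma eulerian_cut_commute: "eulerian_cut G X X' \<Longrightarrow> eulerian_cut G X' X"
  unfolding eulerian_cut_def by blast

lemma eulerian_cut_iff_singular:
  assumes r: "r \<in> mverts G"
  shows "(\<exists>X X'. eulerian_cut G X X') \<longleftrightarrow>
    \<not> laplacian_nonsingular (mends G) (medges G) (mverts G - {r})"
proof
  assume "\<exists>X X'. eulerian_cut G X X'"
  \<comment> \<open>The two sides can be exchanged, so \<open>X\<close> may be taken to be the one
    without \<open>r\<close>.\<close>
  then obtain X X' where X: "eulerian_cut G X X'" "r \<notin> X"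
    using eulerian_cut_commute by (metis IntI empty_iff eulerian_cut_iff)
  then have "X \<subseteq> mverts G - {r}" "X \<noteq> {}" "\<forall>v\<in>mverts G. \<not> odd_cut_degree (mends G) (medges G) X v"
    by (auto simp: eulerian_cut_iff)
  then show "\<not> laplacian_nonsingular (mends G) (medges G) (mverts G - {r})"
    unfolding laplacian_nonsingular_def by blast
next
  let ?d = "odd_cut_degree (mends G) (medges G)"
  assume "\<not> laplacian_nonsingular (mends G) (medges G) (mverts G - {r})"
  then obtain X where X: "X \<subseteq> mverts G - {r}" "X \<noteq> {}" "\<And>v. v \<in> mverts G - {r} \<Longrightarrow> \<not> ?d X v"
    unfolding laplacian_nonsingular_def by blast
  \<comment> \<open>The entries of the Laplacian applied to \<open>X\<close> sum to zero modulo 2,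
    because no edge is cut by the full vertex set. All entries but the one at \<open>r\<close>
    vanish, hence so does that one.\<close>
  have "\<not> ?d X r"
  proof -
    have "cut_edges (mends G) (medges G) (mverts G) = {}"
      using card_mends mends_subset by (auto simp: cut_edges_def Int_absorb2)
    then have "even (card {v \<in> mverts G. ?d X v})"
      using odd_card_odd_cut_degree[OF finite_medges finite_mverts, of "mends G" X] by simp
    moreover have "{v \<in> mverts G. ?d X v} = (if ?d X r then {r} else {})" using X(3) r by auto
    ultimately show ?thesis by (auto split: if_splits)
  qed
  then have "eulerian_cut G X (mverts G - X)" using X r by (auto simp: eulerian_cut_iff)
  then show "\<exists>X X'. eulerian_cut G X X'" by blast
qed

section \<open>Eulerian cuts and harmonic morphisms\<close>

lemma harmonic_morphism_of_eulerian_cut: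
  assumes cut: "eulerian_cut G X X'"
  shows "\<exists>\<phi>. harmonic_morphism G mg_B2 \<phi> \<and> nonconstant G mg_B2 \<phi>"
proof -
  have X: "X \<noteq> {}" "X' \<noteq> {}" "X \<inter> X' = {}" "X \<union> X' = mverts G" using cut by (auto simp: eulerian_cut_def)
  let ?C = "cut_edges (mends G) (medges G) X"
  have "\<exists>x y. mends G e = {x, y} \<and> x \<in> X \<and> y \<in> X'" if "e \<in> ?C" for e
  proof -
    have e: "e \<in> medges G" "odd (card (mends G e \<inter> X))" using that by (auto simp: cut_edges_def)
    then obtain x y where xy: "mends G e = {x, y}" using card_mends[OF e(1)] by (auto simp: card_2_iff)
    then have "x \<in> X \<union> X'" "y \<in> X \<union> X'" using mends_subset[OF e(1)] X by auto
    then show ?thesis using odd_card_ends_Int[OF e(1) xy] e xy by (metis UnE insert_commute)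
  qed
  \<comment> \<open>\<open>s\<close> and \<open>t\<close> select the ends of a cut edge in
    \<open>X\<close> and in \<open>X'\<close>. Their fibres are the sets of cut edges at the
    vertices of either side, so \<open>balanced_bipartition\<close> balances all vertices at
    once.\<close>
  then obtain s t where st: "\<And>e. e \<in> ?C \<Longrightarrow> mends G e = {s e, t e} \<and> s e \<in> X \<and> t e \<in> X'" by metis
  have s: "s e = x \<longleftrightarrow> x \<in> mends G e" if "x \<in> X" "e \<in> ?C" for x e using st[OF that(2)] that X by auto
  have t: "t e = x \<longleftrightarrow> x \<in> mends G e" if "x \<in> X'" "e \<in> ?C" for x e using st[OF that(2)] that X by auto
  have deg: "even (card {e \<in> ?C. x \<in> mends G e})" if "x \<in> mverts G" for x
    using cut that by (auto simp: eulerian_cut_iff odd_cut_degree_def)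
  have es: "even (card {e \<in> ?C. s e = x})" for x
  proof (cases "x \<in> X")
    case True
    then have "{e \<in> ?C. s e = x} = {e \<in> ?C. x \<in> mends G e}" using s by blast
    then show ?thesis using deg[of x] True X by auto
  next
    case False
    then have "{e \<in> ?C. s e = x} = {}" using st by blast
    then show ?thesis by (metis card.empty even_zero)
  qed
  have et: "even (card {e \<in> ?C. t e = x})" for x
  proof (cases "x \<in> X'")
    case True
    then have "{e \<in> ?C. t e = x} = {e \<in> ?C. x \<in> mends G e}" using t by blast
    then show ?thesis using deg[of x] True X by auto
  next
    case False
    then have "{e \<in> ?C. t e = x} = {}" using st by blast
    then show ?thesis by (metis card.empty even_zero)
  qed
  have "finite ?C" using finite_medges by (auto simp: cut_edges_def)
  from balanced_bipartition[OF this es et] obtain A where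
    A: "\<And>x. card {e \<in> ?C. s e = x \<and> e \<in> A} = card {e \<in> ?C. s e = x \<and> e \<notin> A}"
      "\<And>x. card {e \<in> ?C. t e = x \<and> e \<in> A} = card {e \<in> ?C. t e = x \<and> e \<notin> A}" by blast
  \<comment> \<open>A vertex goes to its side of the cut and a cut edge to its colour. An edge that
    is not cut lies within one side, and it meets \<open>X\<close> exactly if that side is
    \<open>X\<close>; it is contracted accordingly.\<close>
  define \<phi> :: "'v + 'e \<Rightarrow> bool + bool" where
    "\<phi> = case_sum (\<lambda>v. Inl (v \<in> X))
      (\<lambda>e. if e \<in> ?C then Inr (e \<in> A) else Inl (mends G e \<inter> X \<noteq> {}))"
  have bal: "card {e \<in> ?C. x \<in> mends G e \<and> e \<in> A} = card {e \<in> ?C. x \<in> mends G e \<and> e \<notin> A}"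
    if "x \<in> mverts G" for x
  proof (cases "x \<in> X")
    case True
    have "{e \<in> ?C. x \<in> mends G e \<and> Q e} = {e \<in> ?C. s e = x \<and> Q e}" for Q using s[OF True] by blast
    then show ?thesis using A(1)[of x] by simp
  next
    case False
    then have "x \<in> X'" using that X by auto
    then have "{e \<in> ?C. x \<in> mends G e \<and> Q e} = {e \<in> ?C. t e = x \<and> Q e}" for Q using t by blast
    then show ?thesis using A(2)[of x] by simp
  qed
  have fib: "{e \<in> medges G. x \<in> mends G e \<and> \<phi> (Inr e) = Inr True} = {e \<in> ?C. x \<in> mends G e \<and> e \<in> A}"
    "{e \<in> medges G. x \<in> mends G e \<and> \<phi> (Inr e) = Inr False} = {e \<in> ?C. x \<in> mends G e \<and> e \<notin> A}" for x
    by (auto simp: \<phi>_def cut_edges_def split: if_splits)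
  have fibre: "card {e \<in> medges G. x \<in> mends G e \<and> \<phi> (Inr e) = Inr e'} =
      card {e \<in> ?C. x \<in> mends G e \<and> e \<in> A}" if "x \<in> mverts G" for x e'
    using bal[OF that] fib[of x] by (cases e') auto
  have contract: "\<phi> (Inr e) = \<phi> (Inl x)" if e: "e \<in> medges G" "e \<notin> ?C" "x \<in> mends G e" for e x
  proof -
    obtain y where y: "mends G e = {x, y}" using e(1,3) by (rule edge_other_end)
    then have "x \<in> X \<longleftrightarrow> y \<in> X" using odd_card_ends_Int[OF e(1) y] e by (auto simp: cut_edges_def)
    then show ?thesis using e y by (auto simp: \<phi>_def)
  qed
  have "mg_morphism G mg_B2 \<phi>"
    unfolding mg_morphism_def
  proof (intro conjI ballI impI)
    show "\<phi> ` (mverts G <+> medges G) \<subseteq> mverts mg_B2 <+> medges mg_B2"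
      by (simp add: mg_B2_def)
    show "\<phi> ` Inl ` mverts G \<subseteq> Inl ` mverts mg_B2" by (auto simp: mg_B2_def \<phi>_def)
    show "(\<exists>e'\<in>medges mg_B2. \<phi> (Inr e) = Inr e' \<and> \<phi> (Inl x) \<in> Inl ` mends mg_B2 e') \<or>
        \<phi> (Inr e) = \<phi> (Inl x)" if "x \<in> mverts G" "e \<in> medges G" "x \<in> mends G e" for x e
      using contract[OF that(2) _ that(3)]
      by (cases "e \<in> ?C") (auto simp: mg_B2_def \<phi>_def)
    show "\<phi> ` Inl ` mends G e = Inl ` mends mg_B2 e'" if "\<phi> (Inr e) = Inr e'" for e e'
    proof -
      have "e \<in> ?C" using that by (auto simp: \<phi>_def split: if_splits)
      then show ?thesis using st[of e] X by (auto simp: \<phi>_def mg_B2_def UNIV_bool)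
    qed
  qed
  then have "harmonic_morphism G mg_B2 \<phi>" unfolding harmonic_morphism_def using fibre by simp
  moreover have "nonconstant G mg_B2 \<phi>"
  proof -
    obtain x x' where "x \<in> X" "x' \<in> X'" using X(1,2) by blast
    then have "x \<in> mverts G" "x' \<in> mverts G" "\<phi> (Inl x) = Inl True" "\<phi> (Inl x') = Inl False"
      using X(3,4) by (auto simp: \<phi>_def)
    then show ?thesis unfolding nonconstant_def by (metis sum.inject(1))
  qed
  ultimately show ?thesis by blast
qed

text \<open>The sides are the two vertex fibres. The cut edges are precisely the edges not
  contracted, and at each vertex harmonicity splits them into two classes of equal size.\<close>

lemma eulerian_cut_of_harmonic_morphism:
  assumes harm: "harmonic_morphism G mg_B2 \<phi>" and nc: "nonconstant G mg_B2 \<phi>"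
  shows "\<exists>X X'. eulerian_cut G X X'"
proof -
  define X where "X = {x \<in> mverts G. \<phi> (Inl x) = Inl True}"
  have mor: "mg_morphism G mg_B2 \<phi>" using harm by (simp add: harmonic_morphism_def)
  have Inl: "\<exists>b. \<phi> (Inl x) = Inl b" if "x \<in> mverts G" for x
  proof -
    have "\<phi> ` Inl ` mverts G \<subseteq> Inl ` mverts mg_B2" using mor by (simp only: mg_morphism_def)
    then show ?thesis using that by blast
  qed
  have eq: "\<phi> (Inl x) = \<phi> (Inl y) \<longleftrightarrow> (x \<in> X \<longleftrightarrow> y \<in> X)" if "x \<in> mverts G" "y \<in> mverts G" for x y
    using Inl[OF that(1)] Inl[OF that(2)] that by (auto simp: X_def)
  have cut_iff: "e \<in> cut_edges (mends G) (medges G) X \<longleftrightarrow> (\<exists>e'. \<phi> (Inr e) = Inr e')"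
    if e: "e \<in> medges G" for e
  proof -
    obtain x y where xy: "mends G e = {x, y}" using card_mends[OF e] by (auto simp: card_2_iff)
    have V: "x \<in> mverts G" "y \<in> mverts G" using mends_subset[OF e] xy by auto
    have "(\<exists>e'. \<phi> (Inr e) = Inr e') \<longleftrightarrow> \<phi> (Inl x) \<noteq> \<phi> (Inl y)"
    proof
      assume "\<exists>e'. \<phi> (Inr e) = Inr e'"
      then obtain e' where e': "\<phi> (Inr e) = Inr e'" by blast
      \<comment> \<open>The condition on both ends jointly is what makes the images of
        \<open>x\<close> and \<open>y\<close> differ.\<close>
      have "\<phi> ` Inl ` mends G e = Inl ` mends mg_B2 e'"
        using mor e e' unfolding mg_morphism_def by (simp add: mg_B2_def)
      then have "{\<phi> (Inl x), \<phi> (Inl y)} = {Inl True, Inl False}"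
        by (auto simp: xy mg_B2_def UNIV_bool)
      then show "\<phi> (Inl x) \<noteq> \<phi> (Inl y)" by (auto simp: doubleton_eq_iff)
    next
      assume ne: "\<phi> (Inl x) \<noteq> \<phi> (Inl y)"
      \<comment> \<open>An edge not sent to an edge would be contracted to the images of both its
        ends, which are distinct here.\<close>
      have *: "(\<exists>e'. \<phi> (Inr e) = Inr e') \<or> \<phi> (Inr e) = \<phi> (Inl z)" if "z \<in> {x, y}" for z
      proof -
        have "z \<in> mverts G" "z \<in> mends G e" using that V xy by auto
        then have "(\<exists>e'\<in>medges mg_B2. \<phi> (Inr e) = Inr e' \<and> \<phi> (Inl z) \<in> Inl ` mends mg_B2 e') \<or>
            \<phi> (Inr e) = \<phi> (Inl z)" using mor e by (simp only: mg_morphism_def)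
        then show ?thesis by blast
      qed
      show "\<exists>e'. \<phi> (Inr e) = Inr e'" using *[of x] *[of y] ne by auto
    qed
    then show ?thesis using e odd_card_ends_Int[OF e xy] eq[OF V] by (auto simp: cut_edges_def)
  qed
  have "\<not> odd_cut_degree (mends G) (medges G) X x" if x: "x \<in> mverts G" for x
  proof -
    let ?D = "\<lambda>e'. {e \<in> medges G. x \<in> mends G e \<and> \<phi> (Inr e) = Inr e'}"
    have "{e \<in> cut_edges (mends G) (medges G) X. x \<in> mends G e} = ?D True \<union> ?D False"
    proof -
      have "e \<in> cut_edges (mends G) (medges G) X \<Longrightarrow> e \<in> medges G" for e by (simp add: cut_edges_def)
      then show ?thesis using cut_iff by (auto simp: ex_bool_eq)
    qed
    moreover have "card (?D True \<union> ?D False) = card (?D True) + card (?D False)"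
      using finite_medges by (intro card_Un_disjoint) auto
    moreover have "card (?D True) = card (?D False)"
    proof -
      have "\<phi> (Inl x) \<in> Inl ` mends mg_B2 e'" for e' using Inl[OF x] by (auto simp: mg_B2_def)
      then show ?thesis using harm x unfolding harmonic_morphism_def by (simp add: mg_B2_def)
    qed
    ultimately show ?thesis by (simp add: odd_cut_degree_def)
  qed
  moreover have "X \<noteq> {}"
  proof
    assume "X = {}"
    then have "\<forall>x\<in>mverts G. \<phi> (Inl x) = Inl False" using Inl by (fastforce simp: X_def)
    then show False using nc by (auto simp: nonconstant_def mg_B2_def)
  qed
  moreover have "mverts G - X \<noteq> {}"
  proof
    assume "mverts G - X = {}"
    then have "\<forall>x\<in>mverts G. \<phi> (Inl x) = Inl True" by (auto simp: X_def)
    then show False using nc by (auto simp: nonconstant_def mg_B2_def)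
  qed
  ultimately have "eulerian_cut G X (mverts G - X)" by (auto simp: eulerian_cut_iff X_def)
  then show ?thesis by blast
qed

section \<open>Combining the equivalences\<close>

lemma eulerian_cut_iff_even: "(\<exists>X X'. eulerian_cut G X X') \<longleftrightarrow> even (num_spanning_trees G)"
proof -
  obtain r where r: "r \<in> mverts G" using connected by (auto simp: mg_connected_def)
  show ?thesis
    unfolding num_spanning_trees_def spanning_trees_eq_rooted_forests[OF r] eulerian_cut_iff_singular[OF r]
    using odd_card_rooted_forests[of "medges G" "mverts G" "mends G" "{r}"]
      finite_medges finite_mverts mends_subset card_mends by blast
qed

end

theorem theorem4p9:
  fixes G :: "('v, 'e) mgraph"
  assumes "multigraph G"
  shows "((\<exists>X X'. eulerian_cut G X X') \<longleftrightarrow>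
            (\<exists>\<phi>. harmonic_morphism G mg_B2 \<phi> \<and> nonconstant G mg_B2 \<phi>)) \<and>
         ((\<exists>\<phi>. harmonic_morphism G mg_B2 \<phi> \<and> nonconstant G mg_B2 \<phi>) \<longleftrightarrow>
            even (num_spanning_trees G))"
proof -
  interpret multigraph G by fact
  have "(\<exists>X X'. eulerian_cut G X X') \<longleftrightarrow>
      (\<exists>\<phi>. harmonic_morphism G mg_B2 \<phi> \<and> nonconstant G mg_B2 \<phi>)"
    by (metis harmonic_morphism_of_eulerian_cut eulerian_cut_of_harmonic_morphism)
  then show ?thesis using eulerian_cut_iff_even by simp
qed

end
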